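(* Let $\mathcal{H}$ be a fixed finite set of connected graphs, let $D$ be the maximum diameter of the graphs in $\mathcal{H}$, and let $\Delta>1$ be an integer. Put $p=\log_{\frac{2\Delta}{2\Delta-1}}\Delta$. Consider the following procedure, applied to an instance $(G,k)$ of $\mathcal{H}$-free Edge Deletion in which $G$ has maximum degree at most $\Delta$ and $G$ contains at least one induced copy of some graph in $\mathcal{H}$: (1) Delete from $G$ all vertices whose distance from $V_{\mathcal{H}}(G)$ is more than $(1+\log_{\frac{2\Delta}{2\Delta-1}}k)D$; call the resulting graph $G'$. (2) If $|V(G')|>2\Delta^{2D+1}\cdot k^{pD+1}$, output the instance $(H_0,0)$, where $H_0$ is a graph in $\mathcal{H}$ with the minimum number of vertices; otherwise output $(G',k)$. Then the output instance has at most $2\Delta^{2D+1}\cdot k^{pD+1}$ vertices, and it is a yes-instance of $\mathcal{H}$-free Edge Deletion if and only if $(G,k)$ is a yes-instance.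
   Context: All graphs are finite and simple. For a set of graphs $\mathcal{H}$, a graph is $\mathcal{H}$-free if it has no induced subgraph isomorphic to a member of $\mathcal{H}$. The problem $\mathcal{H}$-free Edge Deletion: given a graph $G$ and a positive integer $k$ (the parameter), decide whether there exists $E'\subseteq E(G)$ with $|E'|\le k$ such that $G\setminus E'=(V(G),E(G)\setminus E')$ is $\mathcal{H}$-free. $V_{\mathcal{H}}(G)$ denotes the set of all vertices of $G$ that belong to some induced subgraph of $G$ isomorphic to a member of $\mathcal{H}$. The distance from a vertex $v$ to a set of vertices $V'$ is the minimum of the distances from $v$ to the vertices of $V'$. *)

theory Defs
  imports Complex_Main "HOL-Library.Extended_Real"
begin

type_synonym 'a graph = "'a set \<times> 'a set set"

abbreviation verts :: "'a graph \<Rightarrow> 'a set" where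
  "verts \<equiv> fst"

abbreviation edges :: "'a graph \<Rightarrow> 'a set set" where
  "edges \<equiv> snd"

definition simple_graph :: "'a graph \<Rightarrow> bool" where
  "simple_graph G \<longleftrightarrow>
     finite (verts G) \<and> (\<forall>e\<in>edges G. e \<subseteq> verts G \<and> card e = 2)"

definition degree :: "'a graph \<Rightarrow> 'a \<Rightarrow> nat" where
  "degree G v = card {e \<in> edges G. v \<in> e}"

text \<open>Meaningful only for graphs with at least one vertex.\<close>
definition max_degree :: "'a graph \<Rightarrow> nat" where
  "max_degree G = Max (degree G ` verts G)"

definition walk :: "'a graph \<Rightarrow> 'a list \<Rightarrow> bool" where
  "walk G xs \<longleftrightarrow>
     xs \<noteq> [] \<and> set xs \<subseteq> verts G \<and> successively (\<lambda>u v. {u, v} \<in> edges G) xs"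

text \<open>The distance is \<open>\<infinity>\<close> if no walk joins the two vertices.\<close>
definition graph_dist :: "'a graph \<Rightarrow> 'a \<Rightarrow> 'a \<Rightarrow> enat" where
  "graph_dist G u v =
     Inf {enat (length xs - 1) | xs. walk G xs \<and> hd xs = u \<and> last xs = v}"

text \<open>The infimum of a nonempty set of extended naturals is attained.\<close>
definition dist_to_set :: "'a graph \<Rightarrow> 'a \<Rightarrow> 'a set \<Rightarrow> enat" where
  "dist_to_set G v S = (INF u\<in>S. graph_dist G v u)"

text \<open>The graph without vertices does not count as connected.\<close>
definition connected_graph :: "'a graph \<Rightarrow> bool" where
  "connected_graph G \<longleftrightarrow> verts G \<noteq> {} \<and>
     (\<forall>u\<in>verts G. \<forall>v\<in>verts G. \<exists>xs. walk G xs \<and> hd xs = u \<and> last xs = v)"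

definition diameter :: "'a graph \<Rightarrow> enat" where
  "diameter G = (SUP u\<in>verts G. SUP v\<in>verts G. graph_dist G u v)"

definition isomorphic :: "'a graph \<Rightarrow> 'b graph \<Rightarrow> bool" where
  "isomorphic G H \<longleftrightarrow> (\<exists>f. bij_betw f (verts G) (verts H) \<and>
     (\<forall>u\<in>verts G. \<forall>v\<in>verts G. {u, v} \<in> edges G \<longleftrightarrow> {f u, f v} \<in> edges H))"

definition induced_subgraph :: "'a graph \<Rightarrow> 'a set \<Rightarrow> 'a graph" where
  "induced_subgraph G S = (verts G \<inter> S, {e \<in> edges G. e \<subseteq> S})"

text \<open>Vertex sets of the induced copies in \<open>G\<close> of members of \<open>\<H>\<close>.\<close>
definition induced_copies :: "'a graph set \<Rightarrow> 'a graph \<Rightarrow> 'a set set" where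
  "induced_copies \<H> G =
     {S. S \<subseteq> verts G \<and> (\<exists>H\<in>\<H>. isomorphic (induced_subgraph G S) H)}"

definition H_free :: "'a graph set \<Rightarrow> 'a graph \<Rightarrow> bool" where
  "H_free \<H> G \<longleftrightarrow> induced_copies \<H> G = {}"

text \<open>The set $V_{\mathcal{H}}(G)$.\<close>
definition copy_verts :: "'a graph set \<Rightarrow> 'a graph \<Rightarrow> 'a set" where
  "copy_verts \<H> G = \<Union> (induced_copies \<H> G)"

definition delete_edges :: "'a graph \<Rightarrow> 'a set set \<Rightarrow> 'a graph" where
  "delete_edges G F = (verts G, edges G - F)"

definition delete_verts :: "'a graph \<Rightarrow> 'a set \<Rightarrow> 'a graph" where
  "delete_verts G S = induced_subgraph G (verts G - S)"

text \<open>
  Yes-instances of \<open>\<H>\<close>-free Edge Deletion. The parameter value \<open>0\<close> is admitted,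
  because the reduction below may output it.
\<close>
definition yes_instance :: "'a graph set \<Rightarrow> 'a graph \<times> nat \<Rightarrow> bool" where
  "yes_instance \<H> I \<longleftrightarrow> (case I of (G, k) \<Rightarrow>
     \<exists>F. F \<subseteq> edges G \<and> card F \<le> k \<and> H_free \<H> (delete_edges G F))"

definition log_base :: "nat \<Rightarrow> real" where
  "log_base \<Delta> = 2 * real \<Delta> / (2 * real \<Delta> - 1)"

definition far_verts :: "'a graph set \<Rightarrow> nat \<Rightarrow> nat \<Rightarrow> 'a graph \<Rightarrow> nat \<Rightarrow> 'a set" where
  "far_verts \<H> \<Delta> D G k =
     {v \<in> verts G. ereal_of_enat (dist_to_set G v (copy_verts \<H> G))
                     > ereal ((1 + log (log_base \<Delta>) (real k)) * real D)}"

definition size_bound :: "nat \<Rightarrow> nat \<Rightarrow> real \<Rightarrow> nat \<Rightarrow> real" where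
  "size_bound \<Delta> D p k = 2 * real \<Delta> ^ (2 * D + 1) * real k powr (p * real D + 1)"

definition reduce ::
  "'a graph set \<Rightarrow> nat \<Rightarrow> nat \<Rightarrow> real \<Rightarrow> 'a graph \<Rightarrow> 'a graph \<times> nat \<Rightarrow> 'a graph \<times> nat" where
  "reduce \<H> \<Delta> D p H\<^sub>0 I = (case I of (G, k) \<Rightarrow>
     let G' = delete_verts G (far_verts \<H> \<Delta> D G k)
     in if real (card (verts G')) > size_bound \<Delta> D p k then (H\<^sub>0, 0) else (G', k))"

end

theory Submission
  imports Defs
begin

text \<open>
  Let \<open>F\<close> be a minimum solution and \<open>F1\<close> the part of \<open>F\<close> lying inside copies of \<open>G\<close>. Deleting
  all edges that meet an endpoint of \<open>F1\<close> is a solution too, so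
  \<open>card F \<le> 2 * \<Delta> * card F1\<close>. Hence \<open>F - F1\<close>, a minimum solution of \<open>G - F1\<close>, is smaller by
  the factor \<open>(2 * \<Delta> - 1) / (2 * \<Delta>)\<close>, while every copy in \<open>G - F1\<close> is within distance \<open>D\<close> of
  the copies of \<open>G\<close>. Iterating, all edges of \<open>F\<close> are within distance \<open>D * log k\<close> of the copies,
  so copies created by deleting \<open>F\<close> stay within \<open>D * (1 + log k)\<close>: a minimum solution of the
  reduced graph solves \<open>G\<close>. The size bound counts vertices near the at most \<open>2 * k\<close> endpoints
  of a solution, because every copy in \<open>G\<close> contains an edge of it.
\<close>

subsection \<open>Balls around vertex sets\<close>

definition neighbours :: "'a graph \<Rightarrow> 'a set \<Rightarrow> 'a set" where
  "neighbours G X = {v. \<exists>u\<in>X. {u, v} \<in> edges G}"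

text \<open>Endpoints of walks of length exactly \<open>n\<close>, not vertices at distance
  \<open>n\<close>, so layers may overlap. As plain iterates they compose and commute with unions;
  only their union \<open>nball\<close> has to match distances.\<close>

definition layer :: "'a graph \<Rightarrow> 'a set \<Rightarrow> nat \<Rightarrow> 'a set" where
  "layer G X n = (neighbours G ^^ n) X"

definition nball :: "'a graph \<Rightarrow> 'a set \<Rightarrow> nat \<Rightarrow> 'a set" where
  "nball G X n = (\<Union>i\<le>n. layer G X i)"

lemma layer_0 [simp]: "layer G X 0 = X"
  by (simp add: layer_def)

lemma layer_Suc: "layer G X (Suc n) = neighbours G (layer G X n)"
  by (simp add: layer_def)

lemma layer_layer: "layer G (layer G X m) n = layer G X (n + m)"
  by (simp add: layer_def funpow_add)

lemma neighbours_mono: "edges G \<subseteq> edges G' \<Longrightarrow> X \<subseteq> Y \<Longrightarrow> neighbours G X \<subseteq> neighbours G' Y"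
  by (auto simp: neighbours_def)

lemma layer_mono: "edges G \<subseteq> edges G' \<Longrightarrow> X \<subseteq> Y \<Longrightarrow> layer G X n \<subseteq> layer G' Y n"
  by (induction n) (simp_all add: layer_Suc neighbours_mono)

lemma nball_mono:
  "edges G \<subseteq> edges G' \<Longrightarrow> X \<subseteq> Y \<Longrightarrow> m \<le> n \<Longrightarrow> nball G X m \<subseteq> nball G' Y n"
  unfolding nball_def by (intro UN_mono layer_mono) auto

lemma subset_nball: "X \<subseteq> nball G X n"
  unfolding nball_def by (metis UN_upper atMost_iff layer_0 zero_le)

lemma neighbours_UN: "neighbours G (\<Union>i\<in>I. X i) = (\<Union>i\<in>I. neighbours G (X i))"
  by (auto simp: neighbours_def)

lemma layer_UN: "layer G (\<Union>i\<in>I. X i) n = (\<Union>i\<in>I. layer G (X i) n)"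
  by (induction n) (simp_all add: layer_Suc neighbours_UN)

text \<open>Triangle inequality: layers commute with unions, and their indices add under
  composition.\<close>

lemma nball_nball: "nball G (nball G X m) n \<subseteq> nball G X (n + m)"
proof
  fix v assume "v \<in> nball G (nball G X m) n"
  then obtain i j where "i \<le> n" "j \<le> m" "v \<in> layer G X (i + j)"
    by (auto simp: nball_def layer_UN layer_layer)
  then show "v \<in> nball G X (n + m)"
    unfolding nball_def by (metis UN_I add_mono atMost_iff)
qed

section \<open>Layers, walks and distances in simple graphs\<close>

lemma simple_graph_edgeD:
  assumes "simple_graph G" "{u, v} \<in> edges G"
  shows "u \<in> verts G" "v \<in> verts G" "u \<noteq> v"
  using assms unfolding simple_graph_def by (force)+

lemma simple_graph_edge_nonempty:
  assumes "simple_graph G" "e \<in> edges G" shows "e \<noteq> {}"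
  using assms unfolding simple_graph_def by force

lemma simple_graph_finite_edges:
  assumes "simple_graph G" shows "finite (edges G)"
  by (rule finite_subset[of _ "Pow (verts G)"]) (use assms in \<open>auto simp: simple_graph_def\<close>)

lemma layer_subset_verts:
  assumes "simple_graph G" "X \<subseteq> verts G" shows "layer G X n \<subseteq> verts G"
  using assms by (cases n) (auto simp: layer_Suc neighbours_def dest: simple_graph_edgeD)

text \<open>Taking one more neighbour prepends a vertex, so walks run from \<open>v\<close> towards
  \<open>X\<close>, the direction in which \<open>dist_to_set\<close> measures. A walk of
  \<open>n\<close> steps lists \<open>Suc n\<close> vertices.\<close>

lemma mem_layer_iff_walk:
  assumes "simple_graph G" "X \<subseteq> verts G"
  shows "v \<in> layer G X n \<longleftrightarrow> (\<exists>xs. walk G xs \<and> hd xs = v \<and> last xs \<in> X \<and> length xs = Suc n)"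
proof (induction n arbitrary: v)
  case 0
  show ?case
  proof
    assume "v \<in> layer G X 0"
    then show "\<exists>xs. walk G xs \<and> hd xs = v \<and> last xs \<in> X \<and> length xs = Suc 0"
      using assms by (intro exI[of _ "[v]"]) (auto simp: walk_def)
  qed (auto simp: length_Suc_conv)
next
  case (Suc n)
  show ?case
  proof
    assume "v \<in> layer G X (Suc n)"
    then obtain u where u: "u \<in> layer G X n" "{u, v} \<in> edges G"
      by (auto simp: layer_Suc neighbours_def)
    then obtain xs where xs: "walk G xs" "hd xs = u" "last xs \<in> X" "length xs = Suc n"
      using Suc.IH by blast
    have "v \<in> verts G" using simple_graph_edgeD[OF assms(1) u(2)] by blast
    moreover have "xs \<noteq> []" using xs by auto
    ultimately show "\<exists>xs. walk G xs \<and> hd xs = v \<and> last xs \<in> X \<and> length xs = Suc (Suc n)"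
      using xs u by (intro exI[of _ "v # xs"])
        (auto simp: walk_def successively_Cons insert_commute)
  next
    assume "\<exists>xs. walk G xs \<and> hd xs = v \<and> last xs \<in> X \<and> length xs = Suc (Suc n)"
    then obtain ys where ys: "walk G ys" "hd ys = v" "last ys \<in> X" "length ys = Suc (Suc n)"
      by blast
    then obtain xs where eq: "ys = v # xs" and len: "length xs = Suc n"
      by (cases ys) auto
    then have "xs \<noteq> []" by auto
    with ys eq have "walk G xs" "last xs \<in> X" "{hd xs, v} \<in> edges G"
      by (auto simp: walk_def successively_Cons insert_commute)
    with len Suc.IH show "v \<in> layer G X (Suc n)"
      by (auto simp: layer_Suc neighbours_def)
  qed
qed

text \<open>A strict bound on an infimum is witnessed by a member of the set; bounds
  \<open>\<le> enat n\<close> on distances are therefore passed through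
  \<open>< enat (Suc n)\<close>.\<close>

lemma enat_less_Suc_iff: "d < enat (Suc n) \<longleftrightarrow> d \<le> enat n"
  by (cases d) auto

lemma graph_dist_le_iff:
  "graph_dist G u v \<le> enat n \<longleftrightarrow>
     (\<exists>xs. walk G xs \<and> hd xs = u \<and> last xs = v \<and> length xs \<le> Suc n)"
proof -
  have "graph_dist G u v \<le> enat n \<longleftrightarrow> graph_dist G u v < enat (Suc n)"
    by (simp only: enat_less_Suc_iff)
  also have "\<dots> \<longleftrightarrow> (\<exists>xs. walk G xs \<and> hd xs = u \<and> last xs = v \<and> length xs - 1 < Suc n)"
    unfolding graph_dist_def Inf_less_iff by auto
  also have "\<dots> \<longleftrightarrow> (\<exists>xs. walk G xs \<and> hd xs = u \<and> last xs = v \<and> length xs \<le> Suc n)"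
    by (auto simp: walk_def less_Suc_eq_le)
  finally show ?thesis .
qed

lemma dist_to_set_le_iff:
  assumes "simple_graph G" "X \<subseteq> verts G"
  shows "dist_to_set G v X \<le> enat n \<longleftrightarrow> v \<in> nball G X n"
proof -
  have "dist_to_set G v X \<le> enat n \<longleftrightarrow> dist_to_set G v X < enat (Suc n)"
    by (simp only: enat_less_Suc_iff)
  also have "\<dots> \<longleftrightarrow> (\<exists>u\<in>X. graph_dist G v u < enat (Suc n))"
    by (simp add: dist_to_set_def INF_less_iff)
  also have "\<dots> \<longleftrightarrow> (\<exists>u\<in>X. graph_dist G v u \<le> enat n)"
    by (simp only: enat_less_Suc_iff)
  also have "\<dots> \<longleftrightarrow> (\<exists>i\<le>n. \<exists>xs. walk G xs \<and> hd xs = v \<and> last xs \<in> X \<and> length xs = Suc i)"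
    (is "?L \<longleftrightarrow> ?R")
  proof
    assume ?L
    then obtain xs where xs: "walk G xs" "hd xs = v" "last xs \<in> X" "length xs \<le> Suc n"
      by (auto simp: graph_dist_le_iff)
    \<comment> \<open>Walks are nonempty, so the truncated subtraction loses nothing.\<close>
    then have "length xs = Suc (length xs - 1)" by (auto simp: walk_def)
    with xs show ?R by (intro exI[of _ "length xs - 1"]) auto
  next
    assume ?R
    then obtain i xs where xs: "walk G xs" "hd xs = v" "last xs \<in> X" "length xs = Suc i" "i \<le> n"
      by blast
    then have "graph_dist G v (last xs) \<le> enat n"
      unfolding graph_dist_le_iff by (intro exI[of _ xs]) auto
    with xs show ?L by blast
  qed
  also have "\<dots> \<longleftrightarrow> v \<in> nball G X n"
    unfolding nball_def using mem_layer_iff_walk[OF assms] by auto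
  finally show ?thesis .
qed

section \<open>Sizes of balls under a degree bound\<close>

lemma card_neighbours_le:
  assumes "simple_graph G" "\<And>v. degree G v \<le> \<Delta>" "finite X"
  shows "finite (neighbours G X) \<and> card (neighbours G X) \<le> card X * \<Delta>"
proof -
  have one: "finite (neighbours G {u}) \<and> card (neighbours G {u}) \<le> \<Delta>" for u
  proof -
    \<comment> \<open>At a single vertex, distinct neighbours give distinct incident edges; general
      sets follow by a union bound.\<close>
    have inj: "inj_on (\<lambda>v. {u, v}) (neighbours G {u})"
      by (auto simp: inj_on_def doubleton_eq_iff)
    have sub: "(\<lambda>v. {u, v}) ` neighbours G {u} \<subseteq> {e \<in> edges G. u \<in> e}"
      by (auto simp: neighbours_def)
    have fin: "finite {e \<in> edges G. u \<in> e}"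
      using simple_graph_finite_edges[OF assms(1)] by simp
    have "finite (neighbours G {u})"
      using finite_subset[OF sub fin] inj by (rule finite_imageD)
    moreover have "card (neighbours G {u}) \<le> degree G u"
      unfolding degree_def using card_inj_on_le[OF inj sub fin] .
    ultimately show ?thesis using assms(2)[of u] by simp
  qed
  have eq: "neighbours G X = (\<Union>u\<in>X. neighbours G {u})"
    by (auto simp: neighbours_def)
  have "card (neighbours G X) \<le> (\<Sum>u\<in>X. card (neighbours G {u}))"
    unfolding eq using assms(3) by (rule card_UN_le)
  also have "\<dots> \<le> (\<Sum>u\<in>X. \<Delta>)" by (rule sum_mono) (simp add: one)
  finally show ?thesis using one assms(3) by (simp add: eq)
qed

lemma card_layer_le:
  assumes "simple_graph G" "\<And>v. degree G v \<le> \<Delta>" "finite X"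
  shows "finite (layer G X n) \<and> card (layer G X n) \<le> card X * \<Delta> ^ n"
proof (induction n)
  case 0
  then show ?case using assms by simp
next
  case (Suc n)
  then have "finite (neighbours G (layer G X n)) \<and>
      card (neighbours G (layer G X n)) \<le> card (layer G X n) * \<Delta>"
    using card_neighbours_le[OF assms(1,2)] by blast
  moreover have "card (layer G X n) * \<Delta> \<le> card X * \<Delta> ^ n * \<Delta>"
    using Suc by (intro mult_right_mono) auto
  ultimately show ?case unfolding layer_Suc power_Suc2 mult.assoc[symmetric] by linarith
qed

text \<open>The layers are bounded by a geometric sum, which is at most twice its last term because
  \<open>\<Delta> \<ge> 2\<close>.\<close>

lemma card_nball_le:
  assumes "simple_graph G" "\<And>v. degree G v \<le> \<Delta>" "finite X" "\<Delta> > 1"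
  shows "card (nball G X n) \<le> 2 * card X * \<Delta> ^ n"
proof -
  have "card (nball G X n) \<le> (\<Sum>i\<le>n. card (layer G X i))"
    unfolding nball_def by (rule card_UN_le) simp
  also have "\<dots> \<le> (\<Sum>i\<le>n. card X * \<Delta> ^ i)"
    using card_layer_le[OF assms(1-3)] by (intro sum_mono) auto
  also have "\<dots> \<le> 2 * card X * \<Delta> ^ n"
  proof (induction n)
    case (Suc n)
    have "2 * (card X * \<Delta> ^ n) \<le> \<Delta> * (card X * \<Delta> ^ n)"
      using assms(4) by (intro mult_right_mono) auto
    moreover have "\<Delta> * (card X * \<Delta> ^ n) = card X * \<Delta> ^ Suc n"
      by (simp add: mult_ac)
    moreover have "(\<Sum>i\<le>Suc n. card X * \<Delta> ^ i)
        = (\<Sum>i\<le>n. card X * \<Delta> ^ i) + card X * \<Delta> ^ Suc n" by simp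
    ultimately show ?case using Suc.IH unfolding mult.assoc by linarith
  qed simp
  finally show ?thesis .
qed

text \<open>Elements outside the graph have degree 0, so later lemmas can state degree bounds for
  the whole type.\<close>

lemma degree_le_max_degree:
  assumes "simple_graph G" "verts G \<noteq> {}"
  shows "degree G v \<le> max_degree G"
proof (cases "v \<in> verts G")
  case True
  then show ?thesis using assms by (auto simp: max_degree_def simple_graph_def)
next
  case False
  then have "{e \<in> edges G. v \<in> e} = {}" using assms by (auto simp: simple_graph_def)
  then show ?thesis by (metis card.empty degree_def le0)
qed

lemma degree_mono:
  assumes "simple_graph G" "edges G' \<subseteq> edges G"
  shows "degree G' v \<le> degree G v"
  unfolding degree_def
  using assms simple_graph_finite_edges[OF assms(1)] by (intro card_mono) auto

subsection \<open>Induced copies\<close>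

lemma verts_induced_subgraph: "verts (induced_subgraph G S) = verts G \<inter> S"
  and edges_induced_subgraph: "edges (induced_subgraph G S) = {e \<in> edges G. e \<subseteq> S}"
  and verts_delete_edges: "verts (delete_edges G F) = verts G"
  and edges_delete_edges: "edges (delete_edges G F) = edges G - F"
  by (simp_all add: induced_subgraph_def delete_edges_def)

lemmas graph_simps = verts_induced_subgraph edges_induced_subgraph
  verts_delete_edges edges_delete_edges

lemma simple_graph_delete_edges: "simple_graph G \<Longrightarrow> simple_graph (delete_edges G F)"
  by (auto simp: simple_graph_def graph_simps)

lemma simple_graph_induced_subgraph: "simple_graph G \<Longrightarrow> simple_graph (induced_subgraph G S)"
  by (auto simp: simple_graph_def graph_simps)

text \<open>Equal induced subgraphs have equal vertex sets, so the condition
  \<open>S \<subseteq> verts G\<close> transfers along with the isomorphism.\<close>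

lemma induced_copies_cong:
  assumes "induced_subgraph G S = induced_subgraph G' S" "S \<in> induced_copies \<H> G"
  shows "S \<in> induced_copies \<H> G'"
proof -
  have "verts G \<inter> S = verts G' \<inter> S"
    using assms(1) by (metis verts_induced_subgraph)
  then show ?thesis using assms by (auto simp: induced_copies_def)
qed

text \<open>Used mostly in contrapositive form: a copy created or destroyed by deleting
  \<open>F\<close> must contain an edge of \<open>F\<close>.\<close>

lemma induced_copy_delete_edges_iff:
  assumes "\<And>e. e \<in> F \<Longrightarrow> \<not> e \<subseteq> S"
  shows "S \<in> induced_copies \<H> (delete_edges G F) \<longleftrightarrow> S \<in> induced_copies \<H> G"
proof -
  have "induced_subgraph (delete_edges G F) S = induced_subgraph G S"
    using assms by (auto simp: induced_subgraph_def delete_edges_def)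
  then show ?thesis using induced_copies_cong by metis
qed

lemma induced_copies_subset_copy_verts: "S \<in> induced_copies \<H> G \<Longrightarrow> S \<subseteq> copy_verts \<H> G"
  by (auto simp: copy_verts_def)

lemma copy_verts_subset: "copy_verts \<H> G \<subseteq> verts G"
  by (auto simp: copy_verts_def induced_copies_def)

text \<open>Keeps the direction that pulls edges, and hence walks, of \<open>H\<close> back into
  \<open>G\<close>.\<close>

lemma induced_copy_embedding:
  assumes "S \<in> induced_copies \<H> G"
  obtains H f where "H \<in> \<H>" "bij_betw f S (verts H)"
    "\<forall>u\<in>S. \<forall>v\<in>S. {f u, f v} \<in> edges H \<longrightarrow> {u, v} \<in> edges G"
proof -
  obtain H where H: "H \<in> \<H>" "isomorphic (induced_subgraph G S) H" and "S \<subseteq> verts G"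
    using assms unfolding induced_copies_def by blast
  then have vS: "verts (induced_subgraph G S) = S"
    by (simp add: verts_induced_subgraph Int_absorb1)
  obtain f where "bij_betw f S (verts H)"
    and f: "\<forall>u\<in>S. \<forall>v\<in>S. {u, v} \<in> edges (induced_subgraph G S) \<longleftrightarrow> {f u, f v} \<in> edges H"
    using H(2) unfolding isomorphic_def vS by blast
  moreover have "\<forall>u\<in>S. \<forall>v\<in>S. {f u, f v} \<in> edges H \<longrightarrow> {u, v} \<in> edges G"
    using f unfolding edges_induced_subgraph by blast
  ultimately show thesis using that H(1) by blast
qed

lemma induced_copy_nonempty:
  assumes "\<And>H. H \<in> \<H> \<Longrightarrow> simple_graph H \<and> connected_graph H"
    and "S \<in> induced_copies \<H> G"
  shows "S \<noteq> {}"
  using assms by (force simp: induced_copies_def isomorphic_def connected_graph_def graph_simps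
      bij_betw_def)

text \<open>A walk of length at most \<open>D\<close> in \<open>H\<close> pulls back along the
  bijection to a walk in \<open>G\<close> between the corresponding vertices.\<close>

lemma induced_copy_subset_nball:
  assumes \<H>: "\<And>H. H \<in> \<H> \<Longrightarrow> simple_graph H \<and> connected_graph H"
    and diam: "\<And>H. H \<in> \<H> \<Longrightarrow> diameter H \<le> enat D"
    and S: "S \<in> induced_copies \<H> G" and x: "x \<in> S"
  shows "S \<subseteq> nball G {x} D"
proof
  fix y assume y: "y \<in> S"
  obtain H f where H: "H \<in> \<H>" and bij: "bij_betw f S (verts H)"
    and f: "\<And>u v. u \<in> S \<Longrightarrow> v \<in> S \<Longrightarrow> {f u, f v} \<in> edges H \<Longrightarrow> {u, v} \<in> edges G"
    using induced_copy_embedding[OF S] by metis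
  have im: "f u \<in> verts H" if "u \<in> S" for u
    using bij that by (auto simp: bij_betw_def)
  have "graph_dist H (f y) (f x) \<le> diameter H"
    unfolding diameter_def by (rule SUP_upper2[OF im[OF y] SUP_upper[OF im[OF x]]])
  then have "graph_dist H (f y) (f x) \<le> enat D"
    using diam[OF H] by simp
  then have "dist_to_set H (f y) {f x} \<le> enat D" by (simp add: dist_to_set_def)
  then have ball: "f y \<in> nball H {f x} D"
    using dist_to_set_le_iff[of H "{f x}"] \<H>[OF H] im x by simp
  \<comment> \<open>Layers around \<open>f x\<close> pull back one step at a time: the preceding
    vertex \<open>w\<close> lies on an edge of \<open>H\<close>, so it has a preimage in
    \<open>S\<close>.\<close>
  have "v \<in> S \<Longrightarrow> f v \<in> layer H {f x} n \<Longrightarrow> v \<in> layer G {x} n" for v n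
  proof (induction n arbitrary: v)
    case 0
    then show ?case using bij x by (auto simp: bij_betw_def inj_on_def)
  next
    case (Suc n)
    then obtain w where w: "w \<in> layer H {f x} n" "{w, f v} \<in> edges H"
      by (auto simp: layer_Suc neighbours_def)
    then have "w \<in> verts H" using \<H>[OF H] simple_graph_edgeD(1) by metis
    then obtain u where u: "u \<in> S" "w = f u" using bij by (auto simp: bij_betw_def)
    then have "u \<in> layer G {x} n" "{u, v} \<in> edges G" using Suc w f by blast+
    then show ?case by (auto simp: layer_Suc neighbours_def)
  qed
  then show "y \<in> nball G {x} D" using ball y by (auto simp: nball_def)
qed

text \<open>If the copy had a second vertex, connectedness of \<open>H\<close> would give an edge at
  \<open>f x\<close>, which pulls back to an edge at \<open>x\<close>.\<close>

lemma induced_copy_isolated: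
  assumes \<H>: "\<And>H. H \<in> \<H> \<Longrightarrow> simple_graph H \<and> connected_graph H"
    and S: "S \<in> induced_copies \<H> G" and x: "x \<in> S"
    and iso: "\<And>e. e \<in> edges G \<Longrightarrow> x \<notin> e"
  shows "S = {x}"
proof (rule ccontr)
  assume "S \<noteq> {x}"
  then obtain y where y: "y \<in> S" "y \<noteq> x" using x by blast
  obtain H f where H: "H \<in> \<H>" and bij: "bij_betw f S (verts H)"
    and f: "\<And>u v. u \<in> S \<Longrightarrow> v \<in> S \<Longrightarrow> {f u, f v} \<in> edges H \<Longrightarrow> {u, v} \<in> edges G"
    using induced_copy_embedding[OF S] by metis
  have "f x \<in> verts H" "f y \<in> verts H" "f x \<noteq> f y"
    using bij x y by (auto simp: bij_betw_def inj_on_def)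
  then obtain xs where xs: "walk H xs" "hd xs = f x" "last xs = f y"
    using \<H>[OF H] unfolding connected_graph_def by blast
  have "xs \<noteq> []" using xs by (auto simp: walk_def)
  then obtain zs where "xs = f x # zs" using xs by (cases xs) auto
  moreover from this have "zs \<noteq> []" using xs \<open>f x \<noteq> f y\<close> by auto
  ultimately obtain w where "{f x, w} \<in> edges H" "w \<in> verts H"
    using xs by (cases zs) (auto simp: walk_def)
  moreover from this obtain u where "u \<in> S" "w = f u"
    using bij by (auto simp: bij_betw_def)
  ultimately have "{x, u} \<in> edges G" using f x by blast
  then show False using iso by blast
qed

subsection \<open>Minimum solutions\<close>

definition solution :: "'a graph set \<Rightarrow> 'a graph \<Rightarrow> 'a set set \<Rightarrow> bool" where
  "solution \<H> G F \<longleftrightarrow> F \<subseteq> edges G \<and> H_free \<H> (delete_edges G F)"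

definition min_solution :: "'a graph set \<Rightarrow> 'a graph \<Rightarrow> 'a set set \<Rightarrow> bool" where
  "min_solution \<H> G F \<longleftrightarrow> solution \<H> G F \<and> (\<forall>F'. solution \<H> G F' \<longrightarrow> card F \<le> card F')"

lemma yes_instance_iff: "yes_instance \<H> (G, k) \<longleftrightarrow> (\<exists>F. solution \<H> G F \<and> card F \<le> k)"
  by (auto simp: yes_instance_def solution_def)

lemma solution_imp_min_solution:
  assumes "solution \<H> G F"
  obtains F' where "min_solution \<H> G F'" "card F' \<le> card F"
  using ex_has_least_nat[of "solution \<H> G" F card] assms unfolding min_solution_def by blast

text \<open>A copy containing no edge of \<open>F\<close> would survive the deletion.\<close>

lemma solution_hits_copy:
  assumes "solution \<H> G F" "S \<in> induced_copies \<H> G"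
  obtains e where "e \<in> F" "e \<subseteq> S"
  using assms induced_copy_delete_edges_iff[of F S \<H> G]
  unfolding solution_def H_free_def by blast

text \<open>
  Isolating the endpoints of the edges of \<open>F\<close> that lie inside copies already gives a solution:
  a copy that avoids these endpoints is a copy in \<open>G\<close> missed by \<open>F\<close>.
\<close>
lemma min_solution_card_le:
  assumes \<H>: "\<And>H. H \<in> \<H> \<Longrightarrow> simple_graph H \<and> connected_graph H"
    and G: "simple_graph G" and deg: "\<And>v. degree G v \<le> \<Delta>"
    and F: "min_solution \<H> G F"
    and F1: "F1 = {e \<in> F. \<exists>S\<in>induced_copies \<H> G. e \<subseteq> S}"
  shows "card F \<le> 2 * \<Delta> * card F1"
proof -
  have sol: "solution \<H> G F" using F by (simp add: min_solution_def)
  then have FG: "F \<subseteq> edges G" by (simp add: solution_def)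
  then have "F1 \<subseteq> edges G" using F1 by auto
  have finE: "finite (edges G)" by (rule simple_graph_finite_edges[OF G])
  have finF1: "finite F1" using \<open>F1 \<subseteq> edges G\<close> finE finite_subset by blast
  define B where "B = (\<Union>f\<in>F1. {e \<in> edges G. e \<inter> f \<noteq> {}})"
  have "solution \<H> G B"
    unfolding solution_def H_free_def
  proof (intro conjI equals0I)
    show "B \<subseteq> edges G" by (auto simp: B_def)
    fix S assume S: "S \<in> induced_copies \<H> (delete_edges G B)"
    show False
    proof (cases "\<exists>x\<in>S. \<exists>f\<in>F1. x \<in> f")
      case True
      then obtain x f where x: "x \<in> S" "f \<in> F1" "x \<in> f" by blast
      \<comment> \<open>Deleting \<open>B\<close> isolates \<open>x\<close>, so \<open>S\<close> is
        a single vertex. It contains no edge, so it was already a copy in \<open>G\<close>, and no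
        solution could destroy it.\<close>
      have "S = {x}"
        by (rule induced_copy_isolated[OF \<H> S x(1)]) (use x in \<open>auto simp: graph_simps B_def\<close>)
      then have no: "\<not> e \<subseteq> S" if "e \<in> edges G" for e
        using G that card_mono[of "{x}" e] unfolding simple_graph_def by force
      then have "S \<in> induced_copies \<H> G"
        using S induced_copy_delete_edges_iff[of B S] \<open>B \<subseteq> edges G\<close> by blast
      then show False using solution_hits_copy[OF sol] no FG by blast
    next
      case False
      then have "\<not> e \<subseteq> S" if "e \<in> B" for e
        using that by (auto simp: B_def)
      then have SG: "S \<in> induced_copies \<H> G"
        using S induced_copy_delete_edges_iff by blast
      then obtain e where e: "e \<in> F" "e \<subseteq> S" using solution_hits_copy[OF sol] by blast
      then have "e \<in> F1" "e \<noteq> {}" using F1 SG FG simple_graph_edge_nonempty[OF G] by auto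
      then show False using False e by blast
    qed
  qed
  then have "card F \<le> card B" using F by (simp add: min_solution_def)
  also have "\<dots> \<le> (\<Sum>f\<in>F1. card {e \<in> edges G. e \<inter> f \<noteq> {}})"
    unfolding B_def by (rule card_UN_le[OF finF1])
  also have "\<dots> \<le> (\<Sum>f\<in>F1. 2 * \<Delta>)"
  proof (rule sum_mono)
    fix f assume "f \<in> F1"
    then have "card f = 2" using \<open>F1 \<subseteq> edges G\<close> G by (auto simp: simple_graph_def)
    then obtain a b where f: "f = {a, b}" by (auto simp: card_2_iff)
    have "{e \<in> edges G. e \<inter> f \<noteq> {}} = {e \<in> edges G. a \<in> e} \<union> {e \<in> edges G. b \<in> e}"
      using f by auto
    then have "card {e \<in> edges G. e \<inter> f \<noteq> {}} \<le> degree G a + degree G b"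
      by (simp add: degree_def card_Un_le)
    then show "card {e \<in> edges G. e \<inter> f \<noteq> {}} \<le> 2 * \<Delta>"
      using deg[of a] deg[of b] by simp
  qed
  finally show ?thesis by (simp add: mult_ac)
qed

section \<open>Distance from minimum solutions to the copies\<close>

lemma log_base_gt_1: "\<Delta> > 1 \<Longrightarrow> log_base \<Delta> > 1"
  by (simp add: log_base_def)

text \<open>The logarithmic bound in integer form: \<open>i\<close> counts rounds of deleting the
  solution edges inside current copies. Each round shrinks the remaining solution by a factor of at
  least \<open>log_base \<Delta>\<close> and adds at most \<open>D\<close> to the distance.\<close>

lemma min_solution_near_copies:
  assumes \<H>: "\<And>H. H \<in> \<H> \<Longrightarrow> simple_graph H \<and> connected_graph H"
    and diam: "\<And>H. H \<in> \<H> \<Longrightarrow> diameter H \<le> enat D"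
    and \<Delta>: "\<Delta> > 1"
    and "simple_graph G" "\<And>v. degree G v \<le> \<Delta>" "min_solution \<H> G F" "e \<in> F"
  shows "\<exists>i. log_base \<Delta> ^ i \<le> real (card F) \<and> e \<subseteq> nball G (copy_verts \<H> G) (i * D)"
  using assms(4-)
proof (induction "card F" arbitrary: G F rule: less_induct)
  case less
  note G = less.prems(1) and deg = less.prems(2) and F = less.prems(3) and e = less.prems(4)
  define F1 where "F1 = {e \<in> F. \<exists>S\<in>induced_copies \<H> G. e \<subseteq> S}"
  have FG: "F \<subseteq> edges G" using F by (simp add: min_solution_def solution_def)
  then have finF: "finite F" using simple_graph_finite_edges[OF G] finite_subset by blast
  have F1F: "F1 \<subseteq> F" by (auto simp: F1_def)
  then have finF1: "finite F1" using finF finite_subset by blast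
  have "card F > 0" using finF e card_gt_0_iff by blast
  have F1_copies: "f \<subseteq> copy_verts \<H> G" if "f \<in> F1" for f
    using that unfolding F1_def copy_verts_def by blast
  have cardF: "card F = card F1 + card (F - F1)"
    using finF F1F finF1 by (simp add: card_Diff_subset card_mono)
  have card_le: "card F \<le> 2 * \<Delta> * card F1"
    by (rule min_solution_card_le[OF \<H> G deg F F1_def])
  show ?case
  proof (cases "e \<in> F1")
    case True
    then have "e \<subseteq> nball G (copy_verts \<H> G) (0 * D)"
      by (rule order_trans[OF F1_copies subset_nball])
    \<comment> \<open>Zero rounds suffice: \<open>log_base \<Delta> ^ 0 = 1\<close>, and
      \<open>F\<close> contains \<open>e\<close>.\<close>
    then show ?thesis using \<open>card F > 0\<close> by (intro exI[of _ 0]) auto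
  next
    case False
    define G1 where "G1 = delete_edges G F1"
    have G1: "simple_graph G1" unfolding G1_def by (rule simple_graph_delete_edges[OF G])
    have E: "edges G1 \<subseteq> edges G" by (auto simp: G1_def graph_simps)
    have deg1: "degree G1 v \<le> \<Delta>" for v
      using order_trans[OF degree_mono[OF G E] deg] .
    have del: "delete_edges G1 F' = delete_edges G (F1 \<union> F')" for F'
      by (auto simp: G1_def delete_edges_def)
    \<comment> \<open>Exchange argument: a smaller solution of \<open>G1\<close> together with
      \<open>F1\<close> would be a smaller solution of \<open>G\<close>.\<close>
    have sol: "min_solution \<H> G1 (F - F1)"
      unfolding min_solution_def
    proof (intro conjI allI impI)
      have "delete_edges G1 (F - F1) = delete_edges G F"
        unfolding del using F1F by (simp add: Un_absorb1)
      then show "solution \<H> G1 (F - F1)"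
        using F FG by (auto simp: min_solution_def solution_def G1_def edges_delete_edges)
      fix F' assume "solution \<H> G1 F'"
      then have "solution \<H> G (F1 \<union> F')"
        using F1F FG E by (auto simp: solution_def del)
      then have "card F \<le> card (F1 \<union> F')" using F by (simp add: min_solution_def)
      also have "\<dots> \<le> card F1 + card F'" by (rule card_Un_le)
      finally show "card (F - F1) \<le> card F'" using cardF by simp
    qed
    \<comment> \<open>By \<open>card_le\<close>, an empty \<open>F1\<close> would force
      \<open>F\<close> to be empty; so the remaining solution is strictly smaller and the induction
      hypothesis applies.\<close>
    have "card F1 > 0" using card_le \<open>card F > 0\<close> by (cases "card F1") auto
    then have "card (F - F1) < card F" using cardF by simp
    then obtain i where i: "log_base \<Delta> ^ i \<le> real (card (F - F1))"
      "e \<subseteq> nball G1 (copy_verts \<H> G1) (i * D)"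
      using less.hyps[OF _ G1 deg1 sol] e False by blast
    \<comment> \<open>A copy in \<open>G1\<close> is either old or created by deleting some
      \<open>f\<close> in \<open>F1\<close>; then it lies within \<open>D\<close> of an endpoint of
      \<open>f\<close>, which is a vertex of an old copy.\<close>
    have "S \<subseteq> nball G (copy_verts \<H> G) D" if S: "S \<in> induced_copies \<H> G1" for S
    proof (cases "S \<in> induced_copies \<H> G")
      case True
      then show ?thesis by (rule order_trans[OF induced_copies_subset_copy_verts subset_nball])
    next
      case False
      then obtain f where f: "f \<in> F1" "f \<subseteq> S"
        using S induced_copy_delete_edges_iff[of F1 S] unfolding G1_def by blast
      then have "f \<noteq> {}" using F1F FG simple_graph_edge_nonempty[OF G] by auto
      then obtain x where x: "x \<in> f" by blast
      have "S \<subseteq> nball G1 {x} D"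
        by (rule induced_copy_subset_nball[OF \<H> diam S]) (use f x in auto)
      also have "\<dots> \<subseteq> nball G (copy_verts \<H> G) D"
        using E F1_copies[OF f(1)] x by (intro nball_mono) auto
      finally show ?thesis .
    qed
    then have "copy_verts \<H> G1 \<subseteq> nball G (copy_verts \<H> G) D"
      by (auto simp: copy_verts_def)
    then have "nball G1 (copy_verts \<H> G1) (i * D)
        \<subseteq> nball G (nball G (copy_verts \<H> G) D) (i * D)"
      using E by (intro nball_mono) auto
    then have "e \<subseteq> nball G (copy_verts \<H> G) (Suc i * D)"
      using i(2) nball_nball[of G "copy_verts \<H> G" D "i * D"] by (auto simp: add.commute)
    moreover have "log_base \<Delta> ^ Suc i \<le> real (card F)"
    proof -
      \<comment> \<open>Writing \<open>card F1\<close> as \<open>card F - card (F - F1)\<close>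
        turns the bound into \<open>2 * \<Delta> * card (F - F1) \<le> (2 * \<Delta> - 1) * card
        F\<close>, the source of the base of the logarithm.\<close>
      have "real (card F) \<le> real (2 * \<Delta> * card F1)" using card_le of_nat_mono by blast
      then have "real (card F) \<le> 2 * real \<Delta> * (real (card F) - real (card (F - F1)))"
        using cardF by simp
      then have "log_base \<Delta> * real (card (F - F1)) \<le> real (card F)"
        using \<Delta> by (simp add: log_base_def field_simps)
      moreover have "log_base \<Delta> * log_base \<Delta> ^ i \<le> log_base \<Delta> * real (card (F - F1))"
        using i(1) log_base_gt_1[OF \<Delta>] by (intro mult_left_mono) auto
      ultimately show ?thesis by simp
    qed
    ultimately show ?thesis by blast
  qed
qed

section \<open>Passing between a graph and its induced subgraphs\<close>

lemma solution_induced_subgraph: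
  assumes "solution \<H> G F"
  shows "solution \<H> (induced_subgraph G X) {e \<in> F. e \<subseteq> X}"
  unfolding solution_def H_free_def
proof (intro conjI equals0I)
  show "{e \<in> F. e \<subseteq> X} \<subseteq> edges (induced_subgraph G X)"
    using assms by (auto simp: solution_def graph_simps)
  fix S assume S: "S \<in> induced_copies \<H> (delete_edges (induced_subgraph G X) {e \<in> F. e \<subseteq> X})"
  then have "S \<subseteq> X" by (auto simp: induced_copies_def graph_simps)
  \<comment> \<open>Inside \<open>S \<subseteq> X\<close> only edges contained in \<open>X\<close>
    matter, so both deletions leave the same graph on \<open>S\<close>.\<close>
  then have "induced_subgraph (delete_edges (induced_subgraph G X) {e \<in> F. e \<subseteq> X}) S
      = induced_subgraph (delete_edges G F) S"
    by (auto simp: induced_subgraph_def delete_edges_def)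
  then have "S \<in> induced_copies \<H> (delete_edges G F)" using S induced_copies_cong by metis
  then show False using assms by (simp add: solution_def H_free_def)
qed

text \<open>Copies of either graph lie inside \<open>X\<close>, and on subsets of \<open>X\<close>
  both graphs induce the same subgraph.\<close>

lemma copy_verts_induced_subgraph:
  assumes "copy_verts \<H> G \<subseteq> X"
  shows "copy_verts \<H> (induced_subgraph G X) = copy_verts \<H> G"
proof -
  have "induced_subgraph (induced_subgraph G X) S = induced_subgraph G S" if "S \<subseteq> X" for S
    using that by (auto simp: induced_subgraph_def)
  moreover have "S \<subseteq> X" if "S \<in> induced_copies \<H> G \<or> S \<in> induced_copies \<H> (induced_subgraph G X)" for S
    using that assms induced_copies_subset_copy_verts
    by (auto simp: induced_copies_def graph_simps copy_verts_def)
  ultimately have "induced_copies \<H> (induced_subgraph G X) = induced_copies \<H> G"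
    using induced_copies_cong by (metis (no_types, lifting) subsetI subset_antisym)
  then show ?thesis by (simp add: copy_verts_def)
qed

text \<open>The danger is a copy reaching outside \<open>X\<close> after \<open>F\<close> is deleted
  from \<open>G\<close>. Such a copy is new, so it contains an edge of \<open>F\<close>, and the
  slack \<open>D\<close> in \<open>near\<close> keeps it inside the ball after all.\<close>

lemma solution_lift:
  assumes \<H>: "\<And>H. H \<in> \<H> \<Longrightarrow> simple_graph H \<and> connected_graph H"
    and diam: "\<And>H. H \<in> \<H> \<Longrightarrow> diameter H \<le> enat D"
    and G: "simple_graph G" and X: "X = nball G (copy_verts \<H> G) N"
    and F: "solution \<H> (induced_subgraph G X) F"
    and near: "\<And>e. e \<in> F \<Longrightarrow>
      \<exists>m. m + D \<le> N \<and> e \<subseteq> nball (induced_subgraph G X) (copy_verts \<H> (induced_subgraph G X)) m"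
  shows "solution \<H> G F"
  unfolding solution_def H_free_def
proof (intro conjI equals0I)
  let ?G = "induced_subgraph G X"
  have cvX: "copy_verts \<H> G \<subseteq> X" unfolding X by (rule subset_nball)
  have E: "edges ?G \<subseteq> edges G" by (auto simp: graph_simps)
  show FG: "F \<subseteq> edges G" using F E by (auto simp: solution_def)
  fix S assume S: "S \<in> induced_copies \<H> (delete_edges G F)"
  have "S \<subseteq> X"
  proof (cases "S \<in> induced_copies \<H> G")
    case True
    then show ?thesis using induced_copies_subset_copy_verts cvX by blast
  next
    case False
    then obtain e where e: "e \<in> F" "e \<subseteq> S"
      using S induced_copy_delete_edges_iff[of F S] by blast
    then have "e \<noteq> {}" using FG simple_graph_edge_nonempty[OF G] by auto
    then obtain x where x: "x \<in> e" by blast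
    obtain m where m: "m + D \<le> N" "e \<subseteq> nball ?G (copy_verts \<H> ?G) m"
      using near[OF e(1)] by blast
    have xm: "x \<in> nball G (copy_verts \<H> G) m"
      using m x nball_mono[OF E order_refl order_refl] copy_verts_induced_subgraph[OF cvX] by auto
    have "S \<subseteq> nball (delete_edges G F) {x} D"
      using induced_copy_subset_nball[OF \<H> diam S] e x by blast
    also have "\<dots> \<subseteq> nball G (nball G (copy_verts \<H> G) m) D"
      using xm by (intro nball_mono) (auto simp: graph_simps)
    also have "\<dots> \<subseteq> nball G (copy_verts \<H> G) (D + m)" by (rule nball_nball)
    also have "\<dots> \<subseteq> X" unfolding X using m by (intro nball_mono) auto
    finally show ?thesis .
  qed
  then have "induced_subgraph (delete_edges ?G F) S = induced_subgraph (delete_edges G F) S"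
    by (auto simp: induced_subgraph_def delete_edges_def)
  then have "S \<in> induced_copies \<H> (delete_edges ?G F)" using S induced_copies_cong by metis
  then show False using F by (simp add: solution_def H_free_def)
qed

text \<open>Each copy contains an edge of \<open>F\<close> and has diameter at most
  \<open>D\<close>; this lets the kept region be counted from the few endpoints of
  \<open>F\<close>.\<close>

lemma copy_verts_subset_nball_solution:
  assumes \<H>: "\<And>H. H \<in> \<H> \<Longrightarrow> simple_graph H \<and> connected_graph H"
    and diam: "\<And>H. H \<in> \<H> \<Longrightarrow> diameter H \<le> enat D"
    and G: "simple_graph G" and F: "solution \<H> G F"
  shows "copy_verts \<H> G \<subseteq> nball G (\<Union>F) D"
proof -
  have "S \<subseteq> nball G (\<Union>F) D" if S: "S \<in> induced_copies \<H> G" for S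
  proof -
    obtain e where e: "e \<in> F" "e \<subseteq> S" using solution_hits_copy[OF F S] .
    then have "e \<noteq> {}" using F simple_graph_edge_nonempty[OF G] by (auto simp: solution_def)
    then obtain x where x: "x \<in> e" by blast
    have "S \<subseteq> nball G {x} D" using induced_copy_subset_nball[OF \<H> diam S] e x by blast
    also have "\<dots> \<subseteq> nball G (\<Union>F) D" using e x by (intro nball_mono) auto
    finally show ?thesis .
  qed
  then show ?thesis by (auto simp: copy_verts_def)
qed

subsection \<open>The reduction\<close>

text \<open>Distances are naturals or infinite, so the real threshold can be rounded down and the
  kept vertices form a ball.\<close>

lemma delete_far_verts:
  assumes G: "simple_graph G" and "\<Delta> > 1" "k > 0"
  shows "delete_verts G (far_verts \<H> \<Delta> D G k) = induced_subgraph G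
    (nball G (copy_verts \<H> G) (nat \<lfloor>(1 + log (log_base \<Delta>) (real k)) * real D\<rfloor>))"
proof -
  define r where "r = (1 + log (log_base \<Delta>) (real k)) * real D"
  \<comment> \<open>\<open>k \<ge> 1\<close> makes the threshold nonnegative, so \<open>nat\<close>
    does not clip its floor.\<close>
  have "log (log_base \<Delta>) (real k) \<ge> 0"
    using log_base_gt_1[OF assms(2)] assms(3) by simp
  then have r0: "r \<ge> 0" by (simp add: r_def)
  have iff: "ereal_of_enat d \<le> ereal r \<longleftrightarrow> d \<le> enat (nat \<lfloor>r\<rfloor>)" for d
    using r0 by (cases d) (auto simp: le_nat_floor le_nat_iff le_floor_iff)
  have "verts G - far_verts \<H> \<Delta> D G k =
      verts G \<inter> nball G (copy_verts \<H> G) (nat \<lfloor>r\<rfloor>)"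
    unfolding far_verts_def r_def[symmetric]
    using dist_to_set_le_iff[OF G copy_verts_subset[of \<H> G]]
    by (auto simp: iff simp flip: not_le)
  moreover have "induced_subgraph G (verts G \<inter> X) = induced_subgraph G X" for X
    using G by (auto simp: induced_subgraph_def simple_graph_def)
  ultimately show ?thesis by (simp add: delete_verts_def r_def)
qed

lemma diameter_le_Max:
  assumes "finite \<H>" "enat D = Max (diameter ` \<H>)" "H \<in> \<H>"
  shows "diameter H \<le> enat D"
  using assms by simp

text \<open>The identity \<open>a powr log b c = c powr log b a\<close>; it is the origin of the
  exponent \<open>p\<close>.\<close>

lemma powr_log_base:
  assumes "\<Delta> > 1" "k > 0" "p = log (log_base \<Delta>) (real \<Delta>)"
  shows "real \<Delta> powr log (log_base \<Delta>) (real k) = real k powr p"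
proof -
  have "\<Delta> > 0" using assms by simp
  then show ?thesis using assms by (simp add: powr_def log_def)
qed

section \<open>Size estimates for the kept region and for copies\<close>

lemma card_nball_solution_le:
  assumes G: "simple_graph G" and deg: "\<And>v. degree G v \<le> \<Delta>" and \<Delta>: "\<Delta> > 1" and k: "k > 0"
    and p: "p = log (log_base \<Delta>) (real \<Delta>)"
    and F: "F \<subseteq> edges G" "card F \<le> k"
  shows "real (card (nball G (\<Union>F)
      (nat \<lfloor>(1 + log (log_base \<Delta>) (real k)) * real D\<rfloor> + D))) \<le> size_bound \<Delta> D p k"
proof -
  define r where "r = (1 + log (log_base \<Delta>) (real k)) * real D"
  \<comment> \<open>The floor of \<open>r\<close> is the radius used by the procedure; the extra
    \<open>D\<close> is the distance from copies to endpoints of \<open>F\<close>.\<close>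
  define n where "n = nat \<lfloor>r\<rfloor> + D"
  have "log (log_base \<Delta>) (real k) \<ge> 0"
    using log_base_gt_1[OF \<Delta>] k by simp
  then have "r \<ge> 0" by (simp add: r_def)
  have finF: "finite F" using F simple_graph_finite_edges[OF G] finite_subset by blast
  have F2: "finite e \<and> card e = 2" if "e \<in> F" for e
    using that F G finite_subset by (auto simp: simple_graph_def)
  have "card (\<Union>F) \<le> (\<Sum>e\<in>F. card e)"
    using card_UN_le[OF finF, of "\<lambda>e. e"] by simp
  also have "\<dots> \<le> 2 * k" using F2 F by simp
  finally have cF: "card (\<Union>F) \<le> 2 * k" .
  have "finite (\<Union>F)" using finF F2 by blast
  then have "card (nball G (\<Union>F) n) \<le> 2 * card (\<Union>F) * \<Delta> ^ n"
    using card_nball_le[OF G deg _ \<Delta>] by blast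
  also have "\<dots> \<le> 2 * (2 * k) * \<Delta> ^ n" using cF by simp
  finally have "real (card (nball G (\<Union>F) n)) \<le> 2 * (2 * real k) * real \<Delta> ^ n"
    by (metis (mono_tags) of_nat_le_iff of_nat_mult of_nat_numeral of_nat_power)
  also have "\<dots> \<le> 2 * (2 * real k) * (real \<Delta> ^ (2 * D) * real k powr (p * real D))"
  proof (rule mult_left_mono)
    have "real \<Delta> ^ n = real \<Delta> powr (real n)"
      using \<Delta> by (simp add: powr_realpow)
    also have "\<dots> \<le> real \<Delta> powr (r + real D)"
      using \<Delta> \<open>r \<ge> 0\<close> by (intro powr_mono) (auto simp: n_def)
    also have "r + real D = real (2 * D) + log (log_base \<Delta>) (real k) * real D"
      by (simp add: r_def algebra_simps)
    also have "real \<Delta> powr \<dots> = real \<Delta> ^ (2 * D) * (real \<Delta> powr log (log_base \<Delta>) (real k)) powr real D"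
      using \<Delta> powr_realpow[of "real \<Delta>" "2 * D"] by (simp only: powr_add powr_powr)
    also have "\<dots> = real \<Delta> ^ (2 * D) * real k powr (p * real D)"
      using powr_log_base[OF \<Delta> k p] by (simp add: powr_powr)
    finally show "real \<Delta> ^ n \<le> real \<Delta> ^ (2 * D) * real k powr (p * real D)" .
  qed simp
  also have "\<dots> = 2 * (2 * (real \<Delta> ^ (2 * D) * (real k powr (p * real D) * real k)))"
    by (simp add: mult_ac)
  \<comment> \<open>One of the two factors 2 is raised to \<open>\<Delta>\<close>, which gives the
    exponent \<open>2 * D + 1\<close>.\<close>
  also have "\<dots> \<le> 2 * (real \<Delta> * (real \<Delta> ^ (2 * D) * (real k powr (p * real D) * real k)))"
    using \<Delta> by (intro mult_left_mono mult_right_mono) auto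
  also have "\<dots> = size_bound \<Delta> D p k"
    using k by (simp add: size_bound_def powr_add mult_ac)
  finally show ?thesis by (simp add: n_def r_def)
qed

text \<open>The copy lies in a ball of radius \<open>D\<close> about any of its vertices. This
  serves the output \<open>H\<^sub>0\<close>, which is no larger than any copy.\<close>

lemma card_induced_copy_le:
  assumes \<H>: "\<And>H. H \<in> \<H> \<Longrightarrow> simple_graph H \<and> connected_graph H"
    and diam: "\<And>H. H \<in> \<H> \<Longrightarrow> diameter H \<le> enat D"
    and G: "simple_graph G" and deg: "\<And>v. degree G v \<le> \<Delta>" and \<Delta>: "\<Delta> > 1"
    and S: "S \<in> induced_copies \<H> G"
  shows "card S \<le> 2 * \<Delta> ^ D"
proof -
  obtain x where x: "x \<in> S" using induced_copy_nonempty[OF \<H> S] by blast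
  have sub: "S \<subseteq> nball G {x} D" by (rule induced_copy_subset_nball[OF \<H> diam S x])
  have "finite (nball G {x} D)"
    using card_layer_le[OF G deg] by (auto simp: nball_def)
  then have "card S \<le> card (nball G {x} D)" using sub by (rule card_mono)
  also have "\<dots> \<le> 2 * \<Delta> ^ D" using card_nball_le[OF G deg _ \<Delta>, of "{x}"] by simp
  finally show ?thesis .
qed

section \<open>Size and correctness of the output instance\<close>

theorem theorem1:
  fixes \<H> :: "'a graph set" and H\<^sub>0 G :: "'a graph" and \<Delta> D k :: nat and p :: real
    and G_out :: "'a graph" and k_out :: nat
  assumes "finite \<H>"
    and "\<forall>H\<in>\<H>. simple_graph H \<and> connected_graph H"
    and "enat D = Max (diameter ` \<H>)"
    and "\<Delta> > 1"
    and "p = log (2 * real \<Delta> / (2 * real \<Delta> - 1)) (real \<Delta>)"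
    and "H\<^sub>0 \<in> \<H>" and "\<forall>H\<in>\<H>. card (verts H\<^sub>0) \<le> card (verts H)"
    and "simple_graph G" and "k > 0"
    and "max_degree G \<le> \<Delta>"
    and "\<not> H_free \<H> G"
    and "reduce \<H> \<Delta> D p H\<^sub>0 (G, k) = (G_out, k_out)"
  shows "real (card (verts G_out))
           \<le> 2 * real \<Delta> ^ (2 * D + 1) * real k powr (p * real D + 1) \<and>
         (yes_instance \<H> (G_out, k_out) \<longleftrightarrow> yes_instance \<H> (G, k))"
proof -
  have \<H>: "\<And>H. H \<in> \<H> \<Longrightarrow> simple_graph H \<and> connected_graph H" using assms(2) by blast
  have diam: "\<And>H. H \<in> \<H> \<Longrightarrow> diameter H \<le> enat D"
    using diameter_le_Max[OF assms(1,3)] .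
  note \<Delta> = assms(4) and G = assms(8) and k = assms(9)
  have p: "p = log (log_base \<Delta>) (real \<Delta>)" using assms(5) by (simp add: log_base_def)
  \<comment> \<open>This copy shows that \<open>verts G\<close> is nonempty, where
    \<open>max_degree\<close> is meaningful, and later bounds the size of
    \<open>H\<^sub>0\<close>.\<close>
  obtain S where S: "S \<in> induced_copies \<H> G" using assms(11) by (auto simp: H_free_def)
  have "S \<noteq> {}" "S \<subseteq> verts G"
    using induced_copy_nonempty[OF \<H> S] S by (auto simp: induced_copies_def)
  then have "verts G \<noteq> {}" by blast
  then have deg: "degree G v \<le> \<Delta>" for v
    by (rule order_trans[OF degree_le_max_degree[OF G] assms(10)])
  define N where "N = nat \<lfloor>(1 + log (log_base \<Delta>) (real k)) * real D\<rfloor>"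
  define X where "X = nball G (copy_verts \<H> G) N"
  have red: "(G_out, k_out) = (if real (card (verts (induced_subgraph G X))) > size_bound \<Delta> D p k
      then (H\<^sub>0, 0) else (induced_subgraph G X, k))"
    using assms(12)[symmetric]
    unfolding reduce_def Let_def X_def N_def prod.case delete_far_verts[OF G \<Delta> k] .
  have lift: "yes_instance \<H> (induced_subgraph G X, k) \<longleftrightarrow> yes_instance \<H> (G, k)"
  proof
    assume "yes_instance \<H> (G, k)"
    then obtain F where F: "solution \<H> G F" "card F \<le> k" by (auto simp: yes_instance_iff)
    then have "finite F"
      using simple_graph_finite_edges[OF G] finite_subset by (auto simp: solution_def)
    then have "card {e \<in> F. e \<subseteq> X} \<le> card F" by (intro card_mono) auto
    then have "card {e \<in> F. e \<subseteq> X} \<le> k" using F(2) by simp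
    then show "yes_instance \<H> (induced_subgraph G X, k)"
      using solution_induced_subgraph[OF F(1)] unfolding yes_instance_iff by blast
  next
    assume "yes_instance \<H> (induced_subgraph G X, k)"
    then obtain F' where F': "solution \<H> (induced_subgraph G X) F'" "card F' \<le> k"
      by (auto simp: yes_instance_iff)
    \<comment> \<open>Only a minimum solution is known to stay near the copies, so the given one is
      replaced first.\<close>
    obtain F where "min_solution \<H> (induced_subgraph G X) F" "card F \<le> card F'"
      using solution_imp_min_solution[OF F'(1)] .
    with F'(2) have F: "min_solution \<H> (induced_subgraph G X) F" "card F \<le> k" by auto
    have degX: "degree (induced_subgraph G X) v \<le> \<Delta>" for v
      using degree_mono[OF G, of "induced_subgraph G X" v] deg[of v] by (auto simp: graph_simps)
    have near: "\<exists>m. m + D \<le> N \<and>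
        e \<subseteq> nball (induced_subgraph G X) (copy_verts \<H> (induced_subgraph G X)) m"
      if e: "e \<in> F" for e
    proof -
      have "\<exists>i. log_base \<Delta> ^ i \<le> real (card F) \<and> e \<subseteq>
          nball (induced_subgraph G X) (copy_verts \<H> (induced_subgraph G X)) (i * D)"
        by (rule min_solution_near_copies
            [OF \<H> diam \<Delta> simple_graph_induced_subgraph[OF G] degX F(1) e])
      then obtain i where i: "log_base \<Delta> ^ i \<le> real (card F)"
        "e \<subseteq> nball (induced_subgraph G X) (copy_verts \<H> (induced_subgraph G X)) (i * D)"
        by blast
      \<comment> \<open>The edge needs radius \<open>i * D\<close> and a new copy through it another
        \<open>D\<close>; the summand 1 in the threshold pays for the latter. As
        \<open>i * D + D\<close> is an integer, rounding down to \<open>N\<close> is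
        harmless.\<close>
      have "log_base \<Delta> ^ i \<le> real k" using i(1) F(2) by linarith
      then have "real i \<le> log (log_base \<Delta>) (real k)"
        using le_log_of_power log_base_gt_1[OF \<Delta>] by blast
      then have "real (i * D + D) \<le> (1 + log (log_base \<Delta>) (real k)) * real D"
        by (simp add: algebra_simps mult_left_mono)
      then have "i * D + D \<le> N" unfolding N_def by (rule le_nat_floor)
      with i(2) show ?thesis by blast
    qed
    have solX: "solution \<H> (induced_subgraph G X) F" using F(1) by (simp add: min_solution_def)
    have "solution \<H> G F" by (rule solution_lift[OF \<H> diam G X_def solX near])
    with F(2) show "yes_instance \<H> (G, k)" by (auto simp: yes_instance_iff)
  qed
  show ?thesis
  proof (cases "real (card (verts (induced_subgraph G X))) > size_bound \<Delta> D p k")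
    case False
    then show ?thesis using red lift by (auto simp: size_bound_def)
  next
    case True
    then have out: "G_out = H\<^sub>0" "k_out = 0" using red by auto
    have H0: "simple_graph H\<^sub>0" using \<H> assms(6) by blast
    \<comment> \<open>Both instances are no-instances here. A solution of \<open>G\<close> within
      the budget would put the kept region into the ball of radius \<open>N + D\<close> about its
      endpoints, which is too small.\<close>
    have "\<not> yes_instance \<H> (G, k)"
    proof
      assume "yes_instance \<H> (G, k)"
      then obtain F where F: "solution \<H> G F" "card F \<le> k" by (auto simp: yes_instance_iff)
      then have FG: "F \<subseteq> edges G" by (simp add: solution_def)
      have "X \<subseteq> nball G (nball G (\<Union>F) D) N"
        unfolding X_def
        by (intro nball_mono order_refl copy_verts_subset_nball_solution[OF \<H> diam G F(1)])
      also have "\<dots> \<subseteq> nball G (\<Union>F) (N + D)" by (rule nball_nball)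
      finally have sub: "X \<subseteq> nball G (\<Union>F) (N + D)" .
      have "\<Union>F \<subseteq> verts G" using FG G by (auto simp: simple_graph_def)
      then have "nball G (\<Union>F) (N + D) \<subseteq> verts G"
        unfolding nball_def by (intro UN_least layer_subset_verts[OF G])
      then have "finite (nball G (\<Union>F) (N + D))"
        using G finite_subset by (auto simp: simple_graph_def)
      then have "card (verts G \<inter> X) \<le> card (nball G (\<Union>F) (N + D))"
        using sub by (intro card_mono) auto
      moreover have "real (card (nball G (\<Union>F) (N + D))) \<le> size_bound \<Delta> D p k"
        unfolding N_def by (rule card_nball_solution_le[OF G deg \<Delta> k p FG F(2)])
      ultimately show False using True by (simp add: verts_induced_subgraph)
    qed
    moreover have "\<not> yes_instance \<H> (H\<^sub>0, 0)"
    proof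
      assume "yes_instance \<H> (H\<^sub>0, 0)"
      then obtain F where F: "solution \<H> H\<^sub>0 F" "card F = 0" by (auto simp: yes_instance_iff)
      have "induced_subgraph H\<^sub>0 (verts H\<^sub>0) = H\<^sub>0"
        using H0 by (auto simp: induced_subgraph_def simple_graph_def prod_eq_iff)
      moreover have "isomorphic H\<^sub>0 H\<^sub>0"
        unfolding isomorphic_def by (intro exI[of _ id]) auto
      ultimately have "verts H\<^sub>0 \<in> induced_copies \<H> H\<^sub>0"
        using assms(6) by (auto simp: induced_copies_def)
      then obtain e where "e \<in> F" using solution_hits_copy[OF F(1)] by blast
      \<comment> \<open>Infinite sets also have \<open>card\<close> 0, so finiteness is needed to
        conclude that \<open>F\<close> is empty.\<close>
      moreover have "finite F"
        using F(1) simple_graph_finite_edges[OF H0] finite_subset by (auto simp: solution_def)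
      ultimately show False using F(2) by auto
    qed
    moreover have "real (card (verts H\<^sub>0))
        \<le> 2 * real \<Delta> ^ (2 * D + 1) * real k powr (p * real D + 1)"
    proof -
      \<comment> \<open>\<open>S\<close> is a copy of some \<open>H\<close>, and
        \<open>H\<^sub>0\<close> is no larger than \<open>H\<close>, so the size bound for copies
        carries over.\<close>
      obtain H f where "H \<in> \<H>" "bij_betw f S (verts H)"
        using induced_copy_embedding[OF S] .
      then have "card (verts H\<^sub>0) \<le> card S"
        using assms(7) bij_betw_same_card[of f S "verts H"] by simp
      also have "\<dots> \<le> 2 * \<Delta> ^ D" by (rule card_induced_copy_le[OF \<H> diam G deg \<Delta> S])
      also have "\<dots> \<le> 2 * \<Delta> ^ (2 * D + 1)" using \<Delta> by (intro mult_left_mono power_increasing) auto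
      finally have "real (card (verts H\<^sub>0)) \<le> real (2 * \<Delta> ^ (2 * D + 1))"
        using of_nat_mono by blast
      also have "\<dots> = 2 * real \<Delta> ^ (2 * D + 1) * 1" by simp
      also have "\<dots> \<le> 2 * real \<Delta> ^ (2 * D + 1) * real k powr (p * real D + 1)"
      proof (intro mult_left_mono)
        \<comment> \<open>With a nonnegative exponent and \<open>k \<ge> 1\<close>, the power of
          \<open>k\<close> is at least 1, so a bound free of \<open>k\<close> suffices.\<close>
        have "p \<ge> 0" using p log_base_gt_1[OF \<Delta>] \<Delta> by simp
        then show "1 \<le> real k powr (p * real D + 1)"
          using k by (intro ge_one_powr_ge_zero) auto
      qed simp
      finally show ?thesis .
    qed
    ultimately show ?thesis using out by simp
  qed
qed

end
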